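(* Let $K$ be an idempotent, linearly ordered, archimedian, cancellative, commutative semiring, and let $\Sigma=\{\mathsf{d}_1,\dots,\mathsf{d}_n\}$ be a finite set of commuting indeterminates. For every rational series $\mathsf{S}\in K[\Sigma][[X]]$ and every rational series $S\in K[[X]]$, the set $\{\mathsf{S}=S\}=\{d\in K^n : [\mathsf{S}]_d=S\}$ is a semi-polyhedral subset of $K^n$.
   Context: Semiring notions: $K$ (with $\oplus,\otimes,\mathbb{0},\mathbb{1}$, products written by juxtaposition) is commutative if $uv=vu$; idempotent if $u\oplus u=u$; an idempotent semiring is linearly ordered if $u\leq v\iff u\oplus v=v$ is a total order; archimedian if for all $u,v,\lambda,\mu$, ($u\lambda^k\geq v\mu^k$ for all $k\geq0$) implies $v=\mathbb{0}$ or $\lambda\geq\mu$; cancellative if $uv=u'v$ implies $v=\mathbb{0}$ or $u=u'$. For a semiring $\mathsf{K}$, $\mathsf{K}[[X]]$ is the semiring of formal power series $\bigoplus_k S_kX^k$ with coefficientwise sum and Cauchy product; for $S$ with zero constant coefficient, $S^*=\bigoplus_{k\geq0}S^k$. A series is rational if it belongs to the smallest subset of $\mathsf{K}[[X]]$ containing the polynomials $\mathsf{K}[X]$ and closed under $\oplus$, product, and star (applied to series with zero constant coefficient). $K[\Sigma]$ is the semiring of polynomials in the commuting indeterminates $\mathsf{d}_1,\dots,\mathsf{d}_n$ with coefficients in $K$. For $d=(d_1,\dots,d_n)\in K^n$, $[\mathsf{S}]_d\in K[[X]]$ is the series obtained from $\mathsf{S}\in K[\Sigma][[X]]$ by substituting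 $d_i$ for $\mathsf{d}_i$ in every coefficient. A monomial on $K^n$ is $m(x)=u\,x_1^{\alpha_1}\cdots x_n^{\alpha_n}$ ($u\in K$, $\alpha_i\in\mathbb{N}$); a half-space is $\{x: m(x)\geq m'(x)\}$ for monomials $m,m'$; a polyhedron is a finite intersection of half-spaces; a semi-polyhedral set is a finite union of polyhedra. *)

theory Defs
  imports Main "HOL-Library.Poly_Mapping"
begin

definition sr_le :: "'a::comm_semiring_1 \<Rightarrow> 'a \<Rightarrow> bool" where
  "sr_le u v \<longleftrightarrow> u + v = v"

definition idempotent_sr :: "'a::comm_semiring_1 itself \<Rightarrow> bool" where
  "idempotent_sr _ \<longleftrightarrow> (\<forall>u::'a. u + u = u)"

definition linearly_ordered_sr :: "'a::comm_semiring_1 itself \<Rightarrow> bool" where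
  "linearly_ordered_sr _ \<longleftrightarrow> (\<forall>u v::'a. sr_le u v \<or> sr_le v u)"

definition archimedian_sr :: "'a::comm_semiring_1 itself \<Rightarrow> bool" where
  "archimedian_sr _ \<longleftrightarrow> (\<forall>u v l m::'a.
      (\<forall>k::nat. sr_le (v * m ^ k) (u * l ^ k)) \<longrightarrow> v = 0 \<or> sr_le m l)"

definition cancellative_sr :: "'a::comm_semiring_1 itself \<Rightarrow> bool" where
  "cancellative_sr _ \<longleftrightarrow> (\<forall>u u' v::'a. u * v = u' * v \<longrightarrow> v = 0 \<or> u = u')"

definition ser_mult :: "(nat \<Rightarrow> 'a::comm_semiring_1) \<Rightarrow> (nat \<Rightarrow> 'a) \<Rightarrow> nat \<Rightarrow> 'a" where
  "ser_mult f g = (\<lambda>n. \<Sum>i\<le>n. f i * g (n - i))"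

definition ser_one :: "nat \<Rightarrow> 'a::comm_semiring_1" where
  "ser_one = (\<lambda>n. if n = 0 then 1 else 0)"

primrec ser_pow :: "(nat \<Rightarrow> 'a::comm_semiring_1) \<Rightarrow> nat \<Rightarrow> nat \<Rightarrow> 'a" where
  "ser_pow f 0 = ser_one"
| "ser_pow f (Suc k) = ser_mult f (ser_pow f k)"

text \<open>Star of a series with zero constant coefficient: the sum over k of S^k.
  The n-th coefficient of S^k vanishes for k > n, so the n-th coefficient of the
  star is the finite sum below.\<close>
definition ser_star :: "(nat \<Rightarrow> 'a::comm_semiring_1) \<Rightarrow> nat \<Rightarrow> 'a" where
  "ser_star f = (\<lambda>n. \<Sum>k\<le>n. ser_pow f k n)"

definition is_poly_ser :: "(nat \<Rightarrow> 'a::comm_semiring_1) \<Rightarrow> bool" where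
  "is_poly_ser f \<longleftrightarrow> (\<exists>N. \<forall>n>N. f n = 0)"

inductive_set rational_series :: "(nat \<Rightarrow> 'a::comm_semiring_1) set" where
  poly: "is_poly_ser f \<Longrightarrow> f \<in> rational_series"
| plus: "f \<in> rational_series \<Longrightarrow> g \<in> rational_series \<Longrightarrow> (\<lambda>n. f n + g n) \<in> rational_series"
| mult: "f \<in> rational_series \<Longrightarrow> g \<in> rational_series \<Longrightarrow> ser_mult f g \<in> rational_series"
| star: "f \<in> rational_series \<Longrightarrow> f 0 = 0 \<Longrightarrow> ser_star f \<in> rational_series"

type_synonym ('n, 'a) mpoly = "('n \<Rightarrow>\<^sub>0 nat) \<Rightarrow>\<^sub>0 'a"

definition mono_eval :: "('n::finite \<Rightarrow>\<^sub>0 nat) \<Rightarrow> ('n \<Rightarrow> 'a::comm_semiring_1) \<Rightarrow> 'a" where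
  "mono_eval m d = (\<Prod>i\<in>UNIV. d i ^ Poly_Mapping.lookup m i)"

definition mpoly_eval :: "('n::finite, 'a::comm_semiring_1) mpoly \<Rightarrow> ('n \<Rightarrow> 'a) \<Rightarrow> 'a" where
  "mpoly_eval p d = (\<Sum>m\<in>Poly_Mapping.keys p. Poly_Mapping.lookup p m * mono_eval m d)"

definition subst_ser :: "(nat \<Rightarrow> ('n::finite, 'a::comm_semiring_1) mpoly) \<Rightarrow> ('n \<Rightarrow> 'a) \<Rightarrow> nat \<Rightarrow> 'a" where
  "subst_ser S d = (\<lambda>k. mpoly_eval (S k) d)"

definition monomial_fun :: "'a::comm_semiring_1 \<times> ('n::finite \<Rightarrow> nat) \<Rightarrow> ('n \<Rightarrow> 'a) \<Rightarrow> 'a" where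
  "monomial_fun m x = fst m * (\<Prod>i\<in>UNIV. x i ^ snd m i)"

definition half_space ::
  "'a::comm_semiring_1 \<times> ('n::finite \<Rightarrow> nat) \<Rightarrow> 'a \<times> ('n \<Rightarrow> nat) \<Rightarrow> ('n \<Rightarrow> 'a) set" where
  "half_space m m' = {x. sr_le (monomial_fun m' x) (monomial_fun m x)}"

definition polyhedron :: "('n::finite \<Rightarrow> 'a::comm_semiring_1) set \<Rightarrow> bool" where
  "polyhedron P \<longleftrightarrow> (\<exists>H. finite H \<and> P = (\<Inter>(m, m')\<in>H. half_space m m'))"

definition semi_polyhedral :: "('n::finite \<Rightarrow> 'a::comm_semiring_1) set \<Rightarrow> bool" where
  "semi_polyhedral A \<longleftrightarrow> (\<exists>F. finite F \<and> (\<forall>P\<in>F. polyhedron P) \<and> A = \<Union>F)"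

end

theory Submission
  imports Defs "HOL-Computational_Algebra.Formal_Power_Series"
begin

text \<open>In a commutative idempotent semiring \<open>(f + g)\<^sup>* = f\<^sup>* g\<^sup>*\<close> and \<open>(f g\<^sup>*)\<^sup>* = 1 + f f\<^sup>* g\<^sup>*\<close>.
  Hence a rational series with polynomial coefficients becomes, uniformly in \<open>d\<close>, a finite sum of
  terms \<open>c(d) X\<^sup>i (a(d) X\<^sup>L)\<^sup>*\<close>, and its coefficients along each residue class modulo \<open>L\<close> are
  eventually finite sums of geometric sequences \<open>c(d) a(d)\<^sup>k\<close> with \<open>c\<close>, \<open>a\<close> polynomial functions.
  The same holds for the fixed series, where the archimedian axiom makes a single term \<open>e b\<^sup>k\<close>
  dominate eventually. Equality with \<open>e b\<^sup>k\<close> for all \<open>k\<close> amounts to finitely many polynomial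
  (in)equalities in \<open>d\<close>.\<close>

unbundle fps_syntax

section \<open>The star of a power series\<close>

text \<open>Rational series are moved to type \<open>fps\<close> so that semiring algebra applies.
  When \<open>f $ 0 = 0\<close>, the power \<open>f ^ k\<close> starts at degree \<open>k\<close> or
  later, so cutting the sum at \<open>k <= n\<close> loses nothing.\<close>

definition fps_star :: "'a::comm_semiring_1 fps \<Rightarrow> 'a fps" where
  "fps_star f = Abs_fps (\<lambda>n. \<Sum>k\<le>n. (f ^ k) $ n)"

lemma fps_power_nth_eq_0:
  fixes f :: "'a::comm_semiring_1 fps"
  assumes "f $ 0 = 0" "n < k"
  shows "(f ^ k) $ n = 0"
  using assms(2)
proof (induction k arbitrary: n)
  case (Suc k)
  have "f $ i * (f ^ k) $ (n - i) = 0" if "i \<in> {0..n}" for i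
    using that Suc assms(1) by (cases "i = 0") auto
  then show ?case by (simp add: fps_mult_nth)
qed simp

lemma fps_star_unfold:
  fixes f :: "'a::comm_semiring_1 fps"
  assumes f0: "f $ 0 = 0"
  shows "fps_star f = 1 + f * fps_star f"
proof (rule fps_ext)
  fix n
  \<comment> \<open>Up to degree \<open>n\<close> the star agrees with a finite geometric sum, for
    which the unfolding is a shift of the index.\<close>
  have trunc: "fps_star f $ m = (\<Sum>k\<le>n. f ^ k) $ m" if "m \<le> n" for m n
  proof -
    have "(\<Sum>k\<le>m. (f ^ k) $ m) = (\<Sum>k\<le>n. (f ^ k) $ m)"
      using that by (intro sum.mono_neutral_left) (auto intro: fps_power_nth_eq_0[OF f0])
    then show ?thesis by (simp add: fps_star_def fps_sum_nth)
  qed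
  have "(1 + f * fps_star f) $ n = (1 + f * (\<Sum>k\<le>n. f ^ k)) $ n"
    using trunc[of _ n] by (simp add: fps_mult_nth)
  also have "1 + f * (\<Sum>k\<le>n. f ^ k) = (\<Sum>k\<le>Suc n. f ^ k)"
    by (simp add: sum.atMost_Suc_shift sum_distrib_left del: sum.atMost_Suc)
  also have "\<dots> $ n = fps_star f $ n"
    using trunc[of n "Suc n"] by simp
  finally show "fps_star f $ n = (1 + f * fps_star f) $ n" by simp
qed

text \<open>Since \<open>f $ 0 = 0\<close>, coefficient \<open>n\<close> of \<open>f * y\<close>
  involves only coefficients of \<open>y\<close> below \<open>n\<close>, so the equation determines
  \<open>y\<close> recursively. Star identities are then proved without subtraction, by checking
  this equation.\<close>

lemma fps_fixpoint_unique:
  fixes f :: "'a::comm_semiring_1 fps"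
  assumes f0: "f $ 0 = 0" and y: "y = b + f * y" and z: "z = b + f * z"
  shows "y = z"
proof (rule fps_ext)
  fix n show "y $ n = z $ n"
  proof (induction n rule: less_induct)
    case (less n)
    have "f $ i * y $ (n - i) = f $ i * z $ (n - i)" if "i \<le> n" for i
      using f0 less that by (cases "i = 0") auto
    then have "(b + f * y) $ n = (b + f * z) $ n"
      by (simp add: fps_mult_nth)
    then show ?case by (simp flip: y z)
  qed
qed

lemma fps_star_eqI:
  fixes f :: "'a::comm_semiring_1 fps"
  assumes "f $ 0 = 0" "y = 1 + f * y"
  shows "fps_star f = y"
  using fps_fixpoint_unique[OF assms(1) fps_star_unfold[OF assms(1)] assms(2)] .

lemma fps_star_0: "fps_star 0 = (1 :: 'a::comm_semiring_1 fps)"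
  by (rule fps_star_eqI) auto

text \<open>The powers of \<open>f\<close> are grouped by their exponent modulo \<open>s\<close>.
  With \<open>f\<close> a monomial of degree \<open>L\<close>, this replaces the period
  \<open>L\<close> by \<open>L * s\<close>.\<close>

lemma fps_star_powers:
  fixes f :: "'a::comm_semiring_1 fps"
  assumes f0: "f $ 0 = 0" and s: "s > 0"
  shows "fps_star f = (\<Sum>t<s. f ^ t * fps_star (f ^ s))"
proof (rule fps_star_eqI[OF f0])
  let ?B = "fps_star (f ^ s)"
  obtain r where r: "s = Suc r" using s by (cases s) auto
  have B: "?B = 1 + f ^ s * ?B"
    by (rule fps_star_unfold) (use f0 s in \<open>simp add: fps_power_nth_eq_0\<close>)
  have "(\<Sum>t<s. f ^ t * ?B) = ?B + (\<Sum>t<r. f ^ Suc t * ?B)"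
    by (simp add: r sum.lessThan_Suc_shift del: sum.lessThan_Suc)
  also have "\<dots> = 1 + (f ^ s * ?B + (\<Sum>t<r. f ^ Suc t * ?B))"
    by (subst B) (simp add: add.assoc)
  also have "\<dots> = 1 + (\<Sum>t<s. f ^ Suc t * ?B)"
    by (simp add: r add.commute)
  also have "\<dots> = 1 + f * (\<Sum>t<s. f ^ t * ?B)"
    by (simp add: sum_distrib_left mult.assoc)
  finally show "(\<Sum>t<s. f ^ t * ?B) = 1 + f * (\<Sum>t<s. f ^ t * ?B)" .
qed

section \<open>Star identities under idempotent addition\<close>

context
  assumes idem: "\<And>u :: 'a::comm_semiring_1. u + u = u"
begin

lemma fps_add_idem: "f + f = (f :: 'a fps)"
  by (simp add: fps_eq_iff idem)

lemma add_eq_0_left: "u + v = 0 \<Longrightarrow> u = (0::'a)"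
  by (metis add.right_neutral add.assoc idem)

lemma fps_star_add:
  fixes f g :: "'a fps"
  assumes "f $ 0 = 0" "g $ 0 = 0"
  shows "fps_star (f + g) = fps_star f * fps_star g"
proof (rule fps_star_eqI)
  let ?F = "f * fps_star f" and ?G = "g * fps_star g"
  note unf = fps_star_unfold[OF assms(1)] and ung = fps_star_unfold[OF assms(2)]
  have idem_l: "x + (x + y) = x + y" for x y :: "'a fps"
    by (metis add.assoc fps_add_idem)
  have "fps_star f * fps_star g = (1 + ?F) * (1 + ?G)"
    using unf ung by simp
  \<comment> \<open>Idempotence duplicates the cross term \<open>?F * ?G\<close>, so that one copy
    completes \<open>?F * fps_star g\<close> and the other \<open>?G * fps_star f\<close>.\<close>
  also have "\<dots> = 1 + (?F * (1 + ?G) + ?G * (1 + ?F))"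
    by (simp add: algebra_simps idem_l fps_add_idem)
  also have "\<dots> = 1 + (?F * fps_star g + ?G * fps_star f)"
    by (simp flip: unf ung)
  finally show "fps_star f * fps_star g = 1 + (f + g) * (fps_star f * fps_star g)"
    by (simp add: algebra_simps)
qed (use assms in simp)

text \<open>Idempotence gives \<open>fps_star g * fps_star g = fps_star g\<close>, which collapses
  the iterated factor. The identity removes a nested star.\<close>

lemma fps_star_mult_star:
  fixes f g :: "'a fps"
  assumes "f $ 0 = 0" "g $ 0 = 0"
  shows "fps_star (f * fps_star g) = 1 + f * fps_star f * fps_star g"
proof (rule fps_star_eqI)
  have gg: "fps_star g * fps_star g = fps_star g"
    using fps_star_add[OF assms(2,2)] by (simp add: fps_add_idem)
  have "1 + f * fps_star g * (1 + f * fps_star f * fps_star g)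
      = 1 + f * fps_star g + f * (f * fps_star f) * (fps_star g * fps_star g)"
    by (simp add: algebra_simps)
  also have "\<dots> = 1 + f * (1 + f * fps_star f) * fps_star g"
    by (simp add: gg algebra_simps)
  finally show "1 + f * fps_star f * fps_star g
      = 1 + f * fps_star g * (1 + f * fps_star f * fps_star g)"
    by (simp flip: fps_star_unfold[OF assms(1)])
qed (use assms in simp)

end

section \<open>Polynomial functions\<close>

text \<open>Only values at points \<open>d\<close> matter, so polynomials are represented by
  functions. Lists of monomials make addition a concatenation and allow repetitions.\<close>

definition polynomial_funs :: "(('n::finite \<Rightarrow> 'a::comm_semiring_1) \<Rightarrow> 'a) set" where
  "polynomial_funs = range (\<lambda>ms d. \<Sum>m\<leftarrow>ms. monomial_fun m d)"

lemma polynomial_funs_monomial: "monomial_fun m \<in> polynomial_funs"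
  unfolding polynomial_funs_def by (rule range_eqI[of _ _ "[m]"]) auto

lemma polynomial_funs_const: "(\<lambda>d :: 'n::finite \<Rightarrow> 'a::comm_semiring_1. c) \<in> polynomial_funs"
  using polynomial_funs_monomial[of "(c, \<lambda>_. 0) :: 'a \<times> ('n \<Rightarrow> nat)"]
  by (simp add: monomial_fun_def [abs_def])

lemma polynomial_funs_add:
  assumes "f \<in> polynomial_funs" "g \<in> polynomial_funs"
  shows "(\<lambda>d. f d + g d) \<in> polynomial_funs"
proof -
  obtain ms ns where "f = (\<lambda>d. \<Sum>m\<leftarrow>ms. monomial_fun m d)"
      "g = (\<lambda>d. \<Sum>m\<leftarrow>ns. monomial_fun m d)"
    using assms by (auto simp: polynomial_funs_def)
  then show ?thesis
    unfolding polynomial_funs_def by (intro range_eqI[of _ _ "ms @ ns"]) auto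
qed

lemma polynomial_funs_sum_list:
  "(\<And>x. x \<in> set xs \<Longrightarrow> f x \<in> polynomial_funs) \<Longrightarrow> (\<lambda>d. \<Sum>x\<leftarrow>xs. f x d) \<in> polynomial_funs"
  by (induction xs) (auto intro: polynomial_funs_const polynomial_funs_add)

lemma polynomial_funs_sum:
  "(\<And>x. x \<in> A \<Longrightarrow> f x \<in> polynomial_funs) \<Longrightarrow> (\<lambda>d. \<Sum>x\<in>A. f x d) \<in> polynomial_funs"
  by (induction A rule: infinite_finite_induct)
    (auto intro: polynomial_funs_const polynomial_funs_add)

lemma monomial_fun_mult:
  "monomial_fun (u, \<alpha>) d * monomial_fun (v, \<beta>) d = monomial_fun (u * v, \<lambda>i. \<alpha> i + \<beta> i) d"
  by (simp add: monomial_fun_def power_add prod.distrib ac_simps)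

lemma polynomial_funs_mult:
  assumes "f \<in> polynomial_funs" "g \<in> polynomial_funs"
  shows "(\<lambda>d. f d * g d) \<in> polynomial_funs"
proof -
  obtain ms ns where fg: "f = (\<lambda>d. \<Sum>m\<leftarrow>ms. monomial_fun m d)"
      "g = (\<lambda>d. \<Sum>m\<leftarrow>ns. monomial_fun m d)"
    using assms by (auto simp: polynomial_funs_def)
  have "(\<lambda>d. \<Sum>m\<leftarrow>ms. \<Sum>m'\<leftarrow>ns. monomial_fun m d * monomial_fun m' d) \<in> polynomial_funs"
    using polynomial_funs_monomial
    by (intro polynomial_funs_sum_list) (auto simp: monomial_fun_mult split_paired_all)
  then show ?thesis
    by (simp add: fg sum_list_mult_const sum_list_const_mult)
qed

lemma polynomial_funs_power:
  "f \<in> polynomial_funs \<Longrightarrow> (\<lambda>d. f d ^ k) \<in> polynomial_funs"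
  by (induction k) (auto intro: polynomial_funs_const polynomial_funs_mult)

section \<open>Evaluation of multivariate polynomials\<close>

lemma polynomial_funs_mpoly_eval: "mpoly_eval p \<in> polynomial_funs"
proof -
  have "(\<lambda>d. Poly_Mapping.lookup p m * mono_eval m d) \<in> polynomial_funs" for m
    using polynomial_funs_monomial[of "(Poly_Mapping.lookup p m, Poly_Mapping.lookup m)"]
    by (simp add: monomial_fun_def [abs_def] mono_eval_def)
  then show ?thesis
    unfolding mpoly_eval_def [abs_def] by (rule polynomial_funs_sum)
qed

lemma mono_eval_add: "mono_eval (m + m') d = mono_eval m d * mono_eval m' d"
  by (simp add: mono_eval_def lookup_add power_add prod.distrib)

lemma mpoly_eval_0: "mpoly_eval 0 d = 0"
  by (simp add: mpoly_eval_def)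

lemma mpoly_eval_single: "mpoly_eval (Poly_Mapping.single m c) d = c * mono_eval m d"
  by (simp add: mpoly_eval_def)

lemma mpoly_eval_1: "mpoly_eval 1 d = 1"
  using mpoly_eval_single[of 0 1 d] by (simp add: mono_eval_def)

lemma mpoly_eval_add: "mpoly_eval (p + q) d = mpoly_eval p d + mpoly_eval q d"
  unfolding mpoly_eval_def by (rule setsum_keys_plus_distrib) (auto simp: distrib_right)

text \<open>Updating at a fresh key is adding a single term. Multiplicativity of
  \<open>mpoly_eval\<close>, being additive in each factor, thereby reduces to single terms.\<close>

lemma poly_mapping_induct_add [case_names zero single add]:
  fixes p :: "'k \<Rightarrow>\<^sub>0 'b::comm_monoid_add"
  assumes "P 0" and single: "\<And>k c. P (Poly_Mapping.single k c)"
    and add: "\<And>p q. P p \<Longrightarrow> P q \<Longrightarrow> P (p + q)"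
  shows "P p"
proof (induction p rule: update_induct)
  case (update f a b)
  have "Poly_Mapping.update a b f = f + Poly_Mapping.single a b"
    using update(1)
    by (intro poly_mapping_eqI) (auto simp: lookup_add lookup_update lookup_single in_keys_iff when_def)
  then show ?case using add[OF update(3) single] by simp
qed fact

lemma mpoly_eval_mult: "mpoly_eval (p * q) d = mpoly_eval p d * mpoly_eval q d"
proof (induction p rule: poly_mapping_induct_add)
  case (single m c)
  show ?case
  proof (induction q rule: poly_mapping_induct_add)
    case (single m' c')
    show ?case by (simp add: mpoly_eval_single mult_single mono_eval_add ac_simps)
  qed (simp_all add: mpoly_eval_0 mpoly_eval_add distrib_left)
qed (simp_all add: mpoly_eval_0 mpoly_eval_add distrib_right)

section \<open>Star normal forms\<close>

text \<open>The exponents \<open>i\<close> and the period \<open>L\<close> do not vary with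
  \<open>d\<close>; only the scalars \<open>c d\<close> and \<open>a d\<close> do. One period shared
  by all summands lets their stars be merged in products.\<close>

inductive_set star_normal :: "nat \<Rightarrow> (('n::finite \<Rightarrow> 'a::comm_semiring_1) \<Rightarrow> 'a fps) set"
  for L where
  base: "c \<in> polynomial_funs \<Longrightarrow> a \<in> polynomial_funs \<Longrightarrow>
    (\<lambda>d. fps_const (c d) * fps_X ^ i * fps_star (fps_const (a d) * fps_X ^ L)) \<in> star_normal L"
| add: "F \<in> star_normal L \<Longrightarrow> G \<in> star_normal L \<Longrightarrow> (\<lambda>d. F d + G d) \<in> star_normal L"

lemma star_normal_monom:
  "c \<in> polynomial_funs \<Longrightarrow> (\<lambda>d. fps_const (c d) * fps_X ^ i) \<in> star_normal L"
  \<comment> \<open>With \<open>a\<close> the zero function the star is 1.\<close>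
  using star_normal.base[OF _ polynomial_funs_const[of 0], of c i L] by (simp add: fps_star_0)

lemma star_normal_0: "(\<lambda>d. 0) \<in> star_normal L"
  using star_normal_monom[OF polynomial_funs_const[of 0], of 0 L] by simp

lemma star_normal_1: "(\<lambda>d. 1) \<in> star_normal L"
  using star_normal_monom[OF polynomial_funs_const[of 1], of 0 L] by simp

lemma star_normal_sum:
  "(\<And>x. x \<in> A \<Longrightarrow> F x \<in> star_normal L) \<Longrightarrow> (\<lambda>d. \<Sum>x\<in>A. F x d) \<in> star_normal L"
  by (induction A rule: infinite_finite_induct)
    (auto intro: star_normal_0 star_normal.add)

lemma star_normal_polynomial:
  assumes pf: "\<And>k. f k \<in> polynomial_funs" and zero: "\<And>k d. k > N \<Longrightarrow> f k d = 0"
  shows "(\<lambda>d. Abs_fps (\<lambda>k. f k d)) \<in> star_normal L"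
proof -
  have "Abs_fps (\<lambda>k. f k d) = (\<Sum>i\<le>N. fps_const (f i d) * fps_X ^ i)" for d
    using zero[of _ d] by (auto simp: fps_eq_iff fps_sum_nth mult_delta_right not_le)
  then show ?thesis
    using star_normal_sum[of "{..N}", OF star_normal_monom[OF pf]] by simp
qed

text \<open>Serves to bring two normal forms to a common period; the split by residues of
  \<open>fps_star_powers\<close> keeps all scalars polynomial in \<open>d\<close>.\<close>

lemma star_normal_multiple:
  assumes "F \<in> star_normal L" "L > 0" "s > 0"
  shows "F \<in> star_normal (L * s)"
  using assms(1)
proof induction
  case (base c a i)
  have "fps_const (c d) * fps_X ^ i * fps_star (fps_const (a d) * fps_X ^ L)
    = (\<Sum>t<s. fps_const (c d * a d ^ t) * fps_X ^ (i + L * t)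
        * fps_star (fps_const (a d ^ s) * fps_X ^ (L * s)))" for d
    using \<open>L > 0\<close>
    by (subst fps_star_powers[OF _ \<open>s > 0\<close>])
      (simp_all add: sum_distrib_left power_mult_distrib power_add ac_simps
        flip: fps_const_mult power_mult)
  then show ?case
    using base
    by (simp only:) (intro star_normal_sum star_normal.base polynomial_funs_mult
        polynomial_funs_power)
qed (rule star_normal.add)

lemma fps_star_monom_nth:
  assumes "L > 0"
  shows "fps_star (fps_const a * fps_X ^ L) $ n =
    (if n < L then (if n = 0 then 1 else 0)
     else a * fps_star (fps_const a * fps_X ^ L) $ (n - L))"
  using assms
  by (subst fps_star_unfold) (simp_all add: mult.assoc fps_X_power_mult_nth)

lemma fps_star_monom_nth_add:
  assumes "L > 0"
  shows "fps_star (fps_const a * fps_X ^ L) $ (n + L * k)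
    = a ^ k * fps_star (fps_const a * fps_X ^ L) $ n"
proof (induction k)
  case (Suc k)
  then show ?case
    using fps_star_monom_nth[OF assms, of a "n + L * Suc k"] by (simp add: ac_simps)
qed simp

text \<open>Coefficient \<open>n\<close> of a monomial star is \<open>a d\<close> times coefficient
  \<open>n - L\<close>, and the recursion ends in the constants 0 or 1.\<close>

lemma polynomial_funs_star_normal_nth:
  assumes "F \<in> star_normal L" "L > 0"
  shows "(\<lambda>d. F d $ n) \<in> polynomial_funs"
  using assms(1)
proof (induction)
  case (base c a i)
  have star: "(\<lambda>d. fps_star (fps_const (a d) * fps_X ^ L) $ n) \<in> polynomial_funs" for n
  proof (induction n rule: less_induct)
    case (less n)
    then show ?case
      using base(2) \<open>L > 0\<close>
      by (cases "n < L"; subst fps_star_monom_nth)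
        (simp_all add: polynomial_funs_const polynomial_funs_mult)
  qed
  show ?case
    using star base(1)
    by (cases "n < i") (simp_all add: mult.assoc fps_X_power_mult_nth
        polynomial_funs_const polynomial_funs_mult)
qed (auto intro: polynomial_funs_add)

text \<open>From degree \<open>i\<close> on, advancing by \<open>L\<close> multiplies a basic term
  by \<open>a d\<close>. The threshold is uniform in \<open>d\<close>, and the list
  \<open>ps\<close> depends on \<open>n\<close> but on neither \<open>d\<close> nor
  \<open>k\<close>.\<close>

lemma star_normal_eventually:
  assumes "F \<in> star_normal L" "L > 0"
  shows "\<exists>N. \<forall>n\<ge>N. \<exists>ps. set ps \<subseteq> polynomial_funs \<times> polynomial_funs \<and>
    (\<forall>d k. F d $ (n + L * k) = (\<Sum>(c, a)\<leftarrow>ps. c d * a d ^ k))"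
  using assms(1)
proof induction
  case (base c a i)
  let ?s = "\<lambda>n d. fps_star (fps_const (a d) * fps_X ^ L) $ n"
  let ?F = "\<lambda>d. fps_const (c d) * fps_X ^ i * fps_star (fps_const (a d) * fps_X ^ L)"
  have "?F d $ (n + L * k) = ?F d $ n * a d ^ k" if "n \<ge> i" for n d k
    using that fps_star_monom_nth_add[OF \<open>L > 0\<close>, of "a d" "n - i" k]
    by (simp add: mult.assoc fps_X_power_mult_nth ac_simps)
  moreover have "(\<lambda>d. ?F d $ n) \<in> polynomial_funs" for n
    using polynomial_funs_star_normal_nth[OF star_normal.base[OF base(1,2)] \<open>L > 0\<close>] .
  ultimately show ?case
    using base(2)
    by (intro exI[of _ i] allI impI, rule_tac x = "[(\<lambda>d. ?F d $ n, a)]" in exI) simp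
next
  case (add F G)
  then obtain N M where
    N: "\<And>n. n \<ge> N \<Longrightarrow> \<exists>ps. set ps \<subseteq> polynomial_funs \<times> polynomial_funs \<and>
      (\<forall>d k. F d $ (n + L * k) = (\<Sum>(c, a)\<leftarrow>ps. c d * a d ^ k))" and
    M: "\<And>n. n \<ge> M \<Longrightarrow> \<exists>ps. set ps \<subseteq> polynomial_funs \<times> polynomial_funs \<and>
      (\<forall>d k. G d $ (n + L * k) = (\<Sum>(c, a)\<leftarrow>ps. c d * a d ^ k))"
    by blast
  show ?case
  proof (intro exI[of _ "max N M"] allI impI)
    fix n assume "n \<ge> max N M"
    then obtain ps qs where
      "set ps \<subseteq> polynomial_funs \<times> polynomial_funs"
      "\<forall>d k. F d $ (n + L * k) = (\<Sum>(c, a)\<leftarrow>ps. c d * a d ^ k)"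
      "set qs \<subseteq> polynomial_funs \<times> polynomial_funs"
      "\<forall>d k. G d $ (n + L * k) = (\<Sum>(c, a)\<leftarrow>qs. c d * a d ^ k)"
      using N[of n] M[of n] by auto
    then show "\<exists>ps. set ps \<subseteq> polynomial_funs \<times> polynomial_funs \<and>
      (\<forall>d k. (F d + G d) $ (n + L * k) = (\<Sum>(c, a)\<leftarrow>ps. c d * a d ^ k))"
      by (intro exI[of _ "ps @ qs"]) auto
  qed
qed

section \<open>Closure of normal forms under product and star\<close>

context
  assumes idem: "\<And>u :: 'a::comm_semiring_1. u + u = u"
begin

text \<open>By \<open>fps_star_add\<close>, two stars of equal period with scalars \<open>a\<close>
  and \<open>a'\<close> merge into the star with scalar \<open>a + a'\<close>.\<close>

lemma star_normal_mult:
  fixes F G :: "('n::finite \<Rightarrow> 'a) \<Rightarrow> 'a fps"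
  assumes "F \<in> star_normal L" "G \<in> star_normal L" "L > 0"
  shows "(\<lambda>d. F d * G d) \<in> star_normal L"
  using assms(1)
proof induction
  case F: (base c a i)
  show ?case
    using assms(2)
  proof induction
    case G: (base c' a' i')
    have "fps_const (c d) * fps_X ^ i * fps_star (fps_const (a d) * fps_X ^ L) *
        (fps_const (c' d) * fps_X ^ i' * fps_star (fps_const (a' d) * fps_X ^ L)) =
      fps_const (c d * c' d) * fps_X ^ (i + i')
        * fps_star (fps_const (a d + a' d) * fps_X ^ L)" for d
    proof -
      have "fps_star (fps_const (a d + a' d) * fps_X ^ L) =
          fps_star (fps_const (a d) * fps_X ^ L) * fps_star (fps_const (a' d) * fps_X ^ L)"
        using fps_star_add[OF idem, of "fps_const (a d) * fps_X ^ L" "fps_const (a' d) * fps_X ^ L"]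
          \<open>L > 0\<close> by (simp add: distrib_right flip: fps_const_add)
      then show ?thesis
        by (simp add: power_add ac_simps flip: fps_const_mult)
    qed
    then show ?case
      using F G by (simp only:) (intro star_normal.base polynomial_funs_mult polynomial_funs_add)
  next
    case (add G H)
    then show ?case by (auto simp: distrib_left intro: star_normal.add)
  qed
next
  case (add F H)
  then show ?case by (auto simp: distrib_right intro: star_normal.add)
qed

lemma star_normal_mult_multiple:
  fixes F G :: "('n::finite \<Rightarrow> 'a) \<Rightarrow> 'a fps"
  assumes "F \<in> star_normal L" "G \<in> star_normal M" "L > 0" "M > 0"
  shows "(\<lambda>d. F d * G d) \<in> star_normal (L * M)"
  using assms star_normal_multiple[of F L M] star_normal_multiple[of G M L]
  by (intro star_normal_mult) (auto simp: mult.commute)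

text \<open>A sum of terms turns into a product of stars by \<open>fps_star_add\<close>, and a
  single term is flattened by \<open>fps_star_mult_star\<close>. The period changes because
  \<open>fps_star (?x d)\<close> has period \<open>i\<close>.\<close>

lemma star_normal_star:
  fixes F :: "('n::finite \<Rightarrow> 'a) \<Rightarrow> 'a fps"
  assumes "F \<in> star_normal L" "L > 0" "\<And>d. F d $ 0 = 0"
  shows "\<exists>M>0. (\<lambda>d. fps_star (F d)) \<in> star_normal M"
  using assms(1,3)
proof induction
  case (base c a i)
  let ?x = "\<lambda>d. fps_const (c d) * fps_X ^ i" and ?y = "\<lambda>d. fps_const (a d) * fps_X ^ L"
  show ?case
  proof (cases "i = 0")
    case True
    \<comment> \<open>For \<open>i = 0\<close> the constant coefficient of the term is
      \<open>c d\<close> itself.\<close>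
    then have "c d = 0" for d
      using base(3)[of d] \<open>L > 0\<close> by (simp add: fps_star_monom_nth)
    then show ?thesis
      using star_normal_1[of 1] by (auto simp: fps_star_0)
  next
    case False
    have "(\<lambda>d. fps_star (?x d)) \<in> star_normal i"
      using star_normal.base[OF polynomial_funs_const[of 1] base(1), of 0 i] by simp
    from star_normal_mult_multiple[OF this star_normal.base[OF base(1,2)]] False \<open>L > 0\<close>
    have "(\<lambda>d. 1 + fps_star (?x d) * (?x d * fps_star (?y d))) \<in> star_normal (i * L)"
      by (intro star_normal.add star_normal_1) auto
    moreover have "fps_star (?x d * fps_star (?y d)) =
        1 + fps_star (?x d) * (?x d * fps_star (?y d))" for d
      using fps_star_mult_star[OF idem, of "?x d" "?y d"] False \<open>L > 0\<close> by (simp add: ac_simps)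
    ultimately show ?thesis
      using False \<open>L > 0\<close> by (intro exI[of _ "i * L"]) simp
  qed
next
  case (add F G)
  \<comment> \<open>In an idempotent semiring a sum vanishes only if its summands do, so the zero
    constant coefficient is inherited by both parts.\<close>
  have F0: "F d $ 0 = 0" for d
    using add_eq_0_left[OF idem] add.prems[of d] by simp
  have G0: "G d $ 0 = 0" for d
    using F0 add.prems[of d] by simp
  obtain M N where "M > 0" "N > 0" "(\<lambda>d. fps_star (F d)) \<in> star_normal M"
    "(\<lambda>d. fps_star (G d)) \<in> star_normal N"
    using add.IH F0 G0 by blast
  then show ?case
    using star_normal_mult_multiple[of "\<lambda>d. fps_star (F d)" M "\<lambda>d. fps_star (G d)" N]
    by (intro exI[of _ "M * N"]) (simp add: fps_star_add[OF idem] F0 G0)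
qed

text \<open>The family \<open>h\<close> of semiring homomorphisms covers both uses: evaluation of
  polynomial coefficients at \<open>d\<close>, and scalars regarded as constant functions of
  \<open>d\<close>.\<close>

lemma star_normal_rational:
  fixes h :: "'b::comm_semiring_1 \<Rightarrow> ('n::finite \<Rightarrow> 'a) \<Rightarrow> 'a"
  assumes S: "S \<in> rational_series"
    and pf: "\<And>x. h x \<in> polynomial_funs"
    and h0: "\<And>d. h 0 d = 0" and h1: "\<And>d. h 1 d = 1"
    and hadd: "\<And>x y d. h (x + y) d = h x d + h y d"
    and hmult: "\<And>x y d. h (x * y) d = h x d * h y d"
  shows "\<exists>L>0. (\<lambda>d. Abs_fps (\<lambda>k. h (S k) d)) \<in> star_normal L"
  using S
proof induction
  case (poly f)
  then obtain N where "\<And>k. k > N \<Longrightarrow> f k = 0"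
    by (auto simp: is_poly_ser_def)
  then show ?case
    by (intro exI[of _ 1] conjI star_normal_polynomial[of _ N]) (auto simp: pf h0)
next
  case (plus f g)
  then obtain L M where LM: "L > 0" "M > 0"
    "(\<lambda>d. Abs_fps (\<lambda>k. h (f k) d)) \<in> star_normal (L * M)"
    "(\<lambda>d. Abs_fps (\<lambda>k. h (g k) d)) \<in> star_normal (L * M)"
    by (metis star_normal_multiple mult.commute)
  have "Abs_fps (\<lambda>k. h (f k + g k) d) = Abs_fps (\<lambda>k. h (f k) d) + Abs_fps (\<lambda>k. h (g k) d)" for d
    by (simp add: fps_eq_iff hadd)
  then show ?case
    using star_normal.add[OF LM(3,4)] LM(1,2) by (intro exI[of _ "L * M"]) simp
next
  have hsum: "h (\<Sum>x\<in>A. f x) d = (\<Sum>x\<in>A. h (f x) d)" for A d and f :: "nat \<Rightarrow> 'b"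
    by (induction A rule: infinite_finite_induct) (auto simp: h0 hadd)
  have ser_mult: "Abs_fps (\<lambda>k. h (ser_mult f g k) d) =
      Abs_fps (\<lambda>k. h (f k) d) * Abs_fps (\<lambda>k. h (g k) d)" for f g d
    by (simp add: fps_eq_iff ser_mult_def hsum hmult fps_mult_nth atLeast0AtMost)
  {
    case (mult f g)
    then obtain L M where LM: "L > 0" "M > 0"
      "(\<lambda>d. Abs_fps (\<lambda>k. h (f k) d)) \<in> star_normal L"
      "(\<lambda>d. Abs_fps (\<lambda>k. h (g k) d)) \<in> star_normal M"
      by blast
    show ?case
      using star_normal_mult_multiple[OF LM(3,4,1,2)] LM(1,2)
      by (intro exI[of _ "L * M"]) (simp add: ser_mult)
  next
    case (star f)
    have pow: "Abs_fps (\<lambda>k. h (ser_pow f j k) d) = Abs_fps (\<lambda>k. h (f k) d) ^ j" for j d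
    proof (induction j)
      case 0
      show ?case by (simp add: fps_eq_iff ser_one_def h0 h1)
    qed (simp add: ser_mult)
    have "h (ser_pow f j k) d = (Abs_fps (\<lambda>k. h (f k) d) ^ j) $ k" for j k d
      by (simp flip: pow)
    then have "Abs_fps (\<lambda>k. h (ser_star f k) d) = fps_star (Abs_fps (\<lambda>k. h (f k) d))" for d
      by (simp add: fps_eq_iff ser_star_def fps_star_def hsum)
    then show ?case
      using star.IH star_normal_star[of "\<lambda>d. Abs_fps (\<lambda>k. h (f k) d)"] star.hyps
      by (auto simp: h0)
  }
qed

end

section \<open>Semi-polyhedral sets\<close>

lemma polyhedron_Int:
  assumes "polyhedron P" "polyhedron Q"
  shows "polyhedron (P \<inter> Q)"
proof -
  obtain H H' where "finite H" "finite H'" "P = (\<Inter>(m, m')\<in>H. half_space m m')"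
    "Q = (\<Inter>(m, m')\<in>H'. half_space m m')"
    using assms by (auto simp: polyhedron_def)
  then show ?thesis
    unfolding polyhedron_def by (intro exI[of _ "H \<union> H'"]) auto
qed

lemma semi_polyhedral_polyhedron: "polyhedron P \<Longrightarrow> semi_polyhedral P"
  unfolding semi_polyhedral_def by (intro exI[of _ "{P}"]) auto

lemma semi_polyhedral_half_space: "semi_polyhedral (half_space m m')"
  by (rule semi_polyhedral_polyhedron, unfold polyhedron_def) (intro exI[of _ "{(m, m')}"], auto)

lemma semi_polyhedral_UNIV: "semi_polyhedral UNIV"
  by (rule semi_polyhedral_polyhedron, unfold polyhedron_def) (intro exI[of _ "{}"], auto)

lemma semi_polyhedral_empty: "semi_polyhedral {}"
  unfolding semi_polyhedral_def by (intro exI[of _ "{}"]) auto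

lemma semi_polyhedral_disj:
  assumes "semi_polyhedral {d. A d}" "semi_polyhedral {d. B d}"
  shows "semi_polyhedral {d. A d \<or> B d}"
proof -
  obtain F G where "finite F" "finite G" "\<forall>P\<in>F. polyhedron P" "\<forall>P\<in>G. polyhedron P"
    "{d. A d} = \<Union>F" "{d. B d} = \<Union>G"
    using assms by (auto simp: semi_polyhedral_def)
  then show ?thesis
    unfolding semi_polyhedral_def Collect_disj_eq by (intro exI[of _ "F \<union> G"]) auto
qed

lemma semi_polyhedral_conj:
  assumes "semi_polyhedral {d. A d}" "semi_polyhedral {d. B d}"
  shows "semi_polyhedral {d. A d \<and> B d}"
proof -
  obtain F G where FG: "finite F" "finite G" "\<forall>P\<in>F. polyhedron P" "\<forall>P\<in>G. polyhedron P"
    "{d. A d} = \<Union>F" "{d. B d} = \<Union>G"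
    using assms by (auto simp: semi_polyhedral_def)
  then show ?thesis
    unfolding semi_polyhedral_def Collect_conj_eq
    by (intro exI[of _ "(\<lambda>(P, Q). P \<inter> Q) ` (F \<times> G)"]) (auto intro: polyhedron_Int)
qed

lemma semi_polyhedral_Ball:
  assumes "finite I" "\<And>i. i \<in> I \<Longrightarrow> semi_polyhedral {d. A i d}"
  shows "semi_polyhedral {d. \<forall>i\<in>I. A i d}"
  using assms
  by (induction I rule: finite_induct) (auto intro: semi_polyhedral_UNIV semi_polyhedral_conj)

lemma semi_polyhedral_Bex:
  assumes "finite I" "\<And>i. i \<in> I \<Longrightarrow> semi_polyhedral {d. A i d}"
  shows "semi_polyhedral {d. \<exists>i\<in>I. A i d}"
  using assms
  by (induction I rule: finite_induct) (auto intro: semi_polyhedral_empty semi_polyhedral_disj)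

section \<open>Sums of geometric sequences over a linearly ordered semiring\<close>

lemma sr_le_0: "sr_le 0 u"
  by (simp add: sr_le_def)

lemma sr_le_trans: "sr_le u v \<Longrightarrow> sr_le v w \<Longrightarrow> sr_le u w"
  by (metis add.assoc sr_le_def)

lemma sr_le_antisym: "sr_le u v \<Longrightarrow> sr_le v u \<Longrightarrow> u = v"
  by (metis add.commute sr_le_def)

lemma sr_le_mult_right: "sr_le u v \<Longrightarrow> sr_le (u * w) (v * w)"
  by (metis distrib_right sr_le_def)

lemma sr_le_mult: "sr_le u v \<Longrightarrow> sr_le u' v' \<Longrightarrow> sr_le (u * u') (v * v')"
  by (metis mult.commute sr_le_mult_right sr_le_trans)

section \<open>The linear order: sums as maxima, and polynomial inequalities\<close>

context
  assumes idempotent: "idempotent_sr TYPE('a::comm_semiring_1)"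
    and linear: "linearly_ordered_sr TYPE('a)"
begin

lemma sr_add_idem: "u + u = (u::'a)"
  using idempotent by (simp add: idempotent_sr_def)

lemma sr_le_refl: "sr_le u (u::'a)"
  by (simp add: sr_le_def sr_add_idem)

lemma sr_le_total: "sr_le u v \<or> sr_le v (u::'a)"
  using linear by (simp add: linearly_ordered_sr_def)

lemma sr_le_power: "sr_le u (v::'a) \<Longrightarrow> sr_le (u ^ k) (v ^ k)"
  by (induction k) (auto intro: sr_le_mult sr_le_refl)

lemma sr_le_add: "sr_le u (u + v :: 'a)"
  by (simp add: sr_le_def sr_add_idem flip: add.assoc)

lemma add_sr_le_iff: "sr_le (u + v) (w::'a) \<longleftrightarrow> sr_le u w \<and> sr_le v w"
  by (metis add.assoc add.commute sr_le_add sr_le_def sr_le_trans)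

lemma sr_le_add_iff: "sr_le w (u + v :: 'a) \<longleftrightarrow> sr_le w u \<or> sr_le w v"
  by (metis add.commute sr_le_add sr_le_def sr_le_total sr_le_trans)

lemma sum_list_sr_le_iff: "sr_le (\<Sum>x\<leftarrow>xs. f x) (w::'a) \<longleftrightarrow> (\<forall>x\<in>set xs. sr_le (f x) w)"
  by (induction xs) (auto simp: add_sr_le_iff sr_le_0)

text \<open>A sum is the maximum of its terms; the disjunct \<open>sr_le w 0\<close> accounts for
  the empty list.\<close>

lemma sr_le_sum_list_iff:
  "sr_le (w::'a) (\<Sum>x\<leftarrow>xs. f x) \<longleftrightarrow> sr_le w 0 \<or> (\<exists>x\<in>set xs. sr_le w (f x))"
  by (induction xs) (auto simp: sr_le_add_iff)

text \<open>Comparing maxima means that each monomial of \<open>p\<close> is below 0 or below some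
  monomial of \<open>q\<close>, a finite combination of half-spaces.\<close>

lemma semi_polyhedral_le:
  fixes p q :: "('n::finite \<Rightarrow> 'a) \<Rightarrow> 'a"
  assumes "p \<in> polynomial_funs" "q \<in> polynomial_funs"
  shows "semi_polyhedral {d. sr_le (p d) (q d)}"
proof -
  obtain ms ns where pq: "p = (\<lambda>d. \<Sum>m\<leftarrow>ms. monomial_fun m d)"
      "q = (\<lambda>d. \<Sum>m\<leftarrow>ns. monomial_fun m d)"
    using assms by (auto simp: polynomial_funs_def)
  have le: "semi_polyhedral {d. sr_le (monomial_fun m d) (monomial_fun m' d)}"
    for m m' :: "'a \<times> ('n \<Rightarrow> nat)"
    using semi_polyhedral_half_space[of m' m] by (simp add: half_space_def)
  have le_0: "semi_polyhedral {d. sr_le (monomial_fun m d) 0}" for m :: "'a \<times> ('n \<Rightarrow> nat)"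
    using le[of m "(0, \<lambda>_. 0)"] by (simp add: monomial_fun_def)
  show ?thesis
    unfolding pq sum_list_sr_le_iff sr_le_sum_list_iff
    by (intro semi_polyhedral_Ball semi_polyhedral_disj semi_polyhedral_Bex finite_set le le_0)
qed

lemma semi_polyhedral_eq:
  fixes p q :: "('n::finite \<Rightarrow> 'a) \<Rightarrow> 'a"
  assumes "p \<in> polynomial_funs" "q \<in> polynomial_funs"
  shows "semi_polyhedral {d. p d = q d}"
proof -
  have "p d = q d \<longleftrightarrow> sr_le (p d) (q d) \<and> sr_le (q d) (p d)" for d
    using sr_le_antisym sr_le_refl by metis
  then show ?thesis
    using assms by (simp add: semi_polyhedral_conj semi_polyhedral_le)
qed

section \<open>Eventual domination from the archimedian axiom\<close>

context
  assumes archimedian: "archimedian_sr TYPE('a)"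
begin

lemma archimedianD:
  "(\<And>k. sr_le (v * m ^ k) (u * l ^ k)) \<Longrightarrow> v = 0 \<or> sr_le m (l::'a)"
  using archimedian unfolding archimedian_sr_def by blast

text \<open>By the archimedian axiom \<open>e * b ^ k\<close> cannot stay below
  \<open>f * c ^ k\<close> for all \<open>k\<close>. Once it is on top at some \<open>K\<close>, it
  stays there because \<open>c\<close> is below \<open>b\<close>.\<close>

lemma geometric_dominated:
  fixes e b f c :: 'a
  assumes "e \<noteq> 0" "sr_le c b" "\<not> sr_le b c"
  obtains K where "\<And>k. e * b ^ (K + k) + f * c ^ (K + k) = e * b ^ K * b ^ k"
proof -
  obtain K where "\<not> sr_le (e * b ^ K) (f * c ^ K)"
    using archimedianD assms by blast
  then have "sr_le (f * c ^ K) (e * b ^ K)"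
    using sr_le_total by blast
  then have "sr_le (f * c ^ (K + k)) (e * b ^ (K + k))" for k
    using sr_le_mult[OF _ sr_le_power[OF assms(2), of k]]
    by (fastforce simp: power_add simp flip: mult.assoc)
  then have "e * b ^ (K + k) + f * c ^ (K + k) = e * b ^ K * b ^ k" for k
    by (simp add: sr_le_def add.commute[of "e * _"] power_add mult.assoc)
  then show thesis by (rule that)
qed

text \<open>Zero coefficients and equal bases are settled with \<open>K = 0\<close>; otherwise the
  term with the strictly larger base wins.\<close>

lemma geometric_add_eventually:
  fixes e b f c :: 'a
  obtains K g a where "\<And>k. e * b ^ (K + k) + f * c ^ (K + k) = g * a ^ k"
proof (cases "e = 0 \<or> f = 0 \<or> b = c")
  case True
  then consider "e = 0" | "f = 0" | "b = c" by blast
  then show thesis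
  proof cases
    case 1 then show thesis using that[of 0 f c] by simp
  next
    case 2 then show thesis using that[of 0 e b] by simp
  next
    case 3 then show thesis using that[of 0 "e + f" c] by (simp add: distrib_right)
  qed
next
  case False
  then consider "sr_le c b" "\<not> sr_le b c" | "sr_le b c" "\<not> sr_le c b"
    using sr_le_total sr_le_antisym by blast
  then show thesis
  proof cases
    case 1 then show thesis using geometric_dominated[of e c b f] that False by metis
  next
    case 2 then show thesis using geometric_dominated[of f b c e] that False
      by (metis add.commute)
  qed
qed

text \<open>Meant for the fixed series: \<open>K\<close> depends on the actual scalars, so for
  scalars varying with \<open>d\<close> it would not be uniform.\<close>

lemma geometric_sum_eventually:
  fixes es :: "('a \<times> 'a) list"
  shows "\<exists>K e b. \<forall>k. (\<Sum>(e, b)\<leftarrow>es. e * b ^ (K + k)) = e * b ^ k"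
proof (induction es)
  case Nil
  show ?case by (auto intro: exI[of _ 0])
next
  case (Cons p es)
  obtain f c where p: "p = (f, c)" by fastforce
  obtain K e b where K: "\<And>k. (\<Sum>(e, b)\<leftarrow>es. e * b ^ (K + k)) = e * b ^ k"
    using Cons by blast
  \<comment> \<open>The new term has to be shifted by the old threshold first, whence the
    coefficient \<open>f * c ^ K\<close>.\<close>
  obtain K' g a where K': "\<And>k. (f * c ^ K) * c ^ (K' + k) + e * b ^ (K' + k) = g * a ^ k"
    using geometric_add_eventually[of "f * c ^ K" c e b] by blast
  have "(\<Sum>(e, b)\<leftarrow>p # es. e * b ^ (K + K' + k)) = g * a ^ k" for k
    using K[of "K' + k"] K'[of k] by (simp add: p power_add mult.assoc add.assoc)
  then show ?case by blast
qed

section \<open>Deciding equality with one geometric sequence by cancellation\<close>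

context
  assumes cancellative: "cancellative_sr TYPE('a)"
begin

lemma sr_mult_cancel: "u * v = u' * v \<Longrightarrow> v \<noteq> 0 \<Longrightarrow> u = (u'::'a)"
  using cancellative unfolding cancellative_sr_def by blast

text \<open>Equality with \<open>e b\<^sup>k\<close> is decided by the two exponents \<open>0\<close> and \<open>1\<close>: if \<open>e b \<noteq> 0\<close>, a summand
  attaining \<open>e b\<close> at exponent \<open>1\<close> must have \<open>c = e\<close> and \<open>a = b\<close>.\<close>

lemma geometric_sum_eq_iff:
  fixes ps :: "('a \<times> 'a) list"
  shows "(\<forall>k. (\<Sum>(c, a)\<leftarrow>ps. c * a ^ k) = e * b ^ k) \<longleftrightarrow>
    (\<Sum>(c, a)\<leftarrow>ps. c) = e \<and> (\<Sum>(c, a)\<leftarrow>ps. c * a) = e * b \<and>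
    (\<forall>(c, a)\<in>set ps. c = 0 \<or> sr_le a b)" (is "?L \<longleftrightarrow> ?R")
proof
  assume L: ?L
  have "c = 0 \<or> sr_le a b" if "(c, a) \<in> set ps" for c a
  proof (rule archimedianD)
    fix k
    have "sr_le (\<Sum>(c, a)\<leftarrow>ps. c * a ^ k) (e * b ^ k)"
      using L sr_le_refl by simp
    then show "sr_le (c * a ^ k) (e * b ^ k)"
      using that by (auto simp: sum_list_sr_le_iff)
  qed
  then show ?R
    using L[rule_format, of 0] L[rule_format, of 1] by (auto simp: case_prod_unfold)
next
  assume R: ?R
  then have "sr_le (\<Sum>(c, a)\<leftarrow>ps. c) e"
    using sr_le_refl by simp
  then have ce: "sr_le c e" if "(c, a) \<in> set ps" for c a
    using that by (auto simp: sum_list_sr_le_iff)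
  have le: "sr_le (c * a ^ k) (e * b ^ k)" if "(c, a) \<in> set ps" for c a k
  proof (cases "c = 0")
    case False
    then have "sr_le a b" using R that by auto
    then show ?thesis using ce[OF that] by (intro sr_le_mult sr_le_power)
  qed (simp add: sr_le_0)
  show ?L
  proof
    fix k
    have "sr_le (e * b ^ k) (\<Sum>(c, a)\<leftarrow>ps. c * a ^ k)"
    \<comment> \<open>Exponent 0 is the first equation of \<open>?R\<close>; if
      \<open>e * b = 0\<close>, the left side vanishes at all positive exponents.\<close>
    proof (cases "k = 0 \<or> e * b = 0")
      case True
      then consider "k = 0" | j where "k = Suc j" "e * b = 0" by (cases k) auto
      then show ?thesis
      proof cases
        case 1
        then show ?thesis using R sr_le_refl[of e] by simp
      next
        case 2
        then have "e * b ^ k = 0" by (simp flip: mult.assoc)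
        then show ?thesis by (simp add: sr_le_0)
      qed
    next
      case False
      have "sr_le (e * b) (\<Sum>(c, a)\<leftarrow>ps. c * a)"
        using R sr_le_refl by simp
      moreover have "\<not> sr_le (e * b) 0"
        using False by (auto simp: sr_le_def)
      ultimately obtain c a where ca: "(c, a) \<in> set ps" "sr_le (e * b) (c * a)"
        by (auto simp: sr_le_sum_list_iff)
      then have "c \<noteq> 0" using False by (auto simp: sr_le_def)
      then have "sr_le a b" using R ca by auto
      \<comment> \<open>Both chains from \<open>c * a\<close> to \<open>e * b\<close>, through
        \<open>e * a\<close> and through \<open>c * b\<close>, collapse because \<open>e * b\<close>
        is below \<open>c * a\<close>. Cancelling \<open>e\<close> and \<open>b\<close> then
        identifies the pairs, so this summand attains \<open>e * b ^ k\<close> at every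
        exponent.\<close>
      then have "sr_le (c * a) (e * a)" "sr_le (e * a) (e * b)"
        "sr_le (c * a) (c * b)" "sr_le (c * b) (e * b)"
        using ce[OF ca(1)] by (auto intro: sr_le_mult sr_le_refl)
      then have "e * a = e * b" "c * b = e * b"
        using ca(2) by (metis sr_le_antisym sr_le_trans)+
      then have "a = b" "c = e"
        using False sr_mult_cancel[of a e b] sr_mult_cancel[of c b e]
        by (metis mult.commute mult_zero_left mult_zero_right)+
      then show ?thesis
        using ca(1) sr_le_refl by (auto simp: sr_le_sum_list_iff intro!: bexI[of _ "(c, a)"])
    qed
    moreover have "sr_le (\<Sum>(c, a)\<leftarrow>ps. c * a ^ k) (e * b ^ k)"
      using le by (auto simp: sum_list_sr_le_iff)
    ultimately show "(\<Sum>(c, a)\<leftarrow>ps. c * a ^ k) = e * b ^ k"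
      by (intro sr_le_antisym)
  qed
qed

text \<open>The right side is a single geometric sequence from some \<open>K\<close> on. The first
  \<open>K\<close> exponents give separate polynomial equations; the tail is decided by
  \<open>geometric_sum_eq_iff\<close> with each \<open>c d\<close> replaced by
  \<open>c d * a d ^ K\<close>.\<close>

lemma semi_polyhedral_geometric_sum_eq:
  fixes ps :: "((('n::finite \<Rightarrow> 'a) \<Rightarrow> 'a) \<times> (('n \<Rightarrow> 'a) \<Rightarrow> 'a)) list"
    and es :: "('a \<times> 'a) list"
  assumes ps: "set ps \<subseteq> polynomial_funs \<times> polynomial_funs"
  shows "semi_polyhedral
    {d. \<forall>k. (\<Sum>(c, a)\<leftarrow>ps. c d * a d ^ k) = (\<Sum>(e, b)\<leftarrow>es. e * b ^ k)}"
proof -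
  let ?T = "\<lambda>d k. \<Sum>(c, a)\<leftarrow>ps. c d * a d ^ k" and ?S = "\<lambda>k. \<Sum>(e, b)\<leftarrow>es. e * b ^ k"
  obtain K e b where K: "\<And>k. ?S (K + k) = e * b ^ k"
    using geometric_sum_eventually by blast
  have split: "(\<forall>k. ?T d k = ?S k) \<longleftrightarrow>
    (\<forall>k\<in>{..<K}. ?T d k = ?S k) \<and> (\<forall>k. ?T d (K + k) = e * b ^ k)" for d
  proof -
    have "(\<forall>k. Q k) \<longleftrightarrow> (\<forall>k\<in>{..<K}. Q k) \<and> (\<forall>k. Q (K + k))" for Q
      by (metis lessThan_iff le_add_diff_inverse not_less)
    from this[of "\<lambda>k. ?T d k = ?S k"] show ?thesis by (simp only: K)
  qed
  have tail: "(\<forall>k. ?T d (K + k) = e * b ^ k) \<longleftrightarrow>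
    (\<Sum>(c, a)\<leftarrow>ps. c d * a d ^ K) = e \<and> (\<Sum>(c, a)\<leftarrow>ps. c d * a d ^ K * a d) = e * b \<and>
    (\<forall>(c, a)\<in>set ps. c d * a d ^ K = 0 \<or> sr_le (a d) b)" for d
    using geometric_sum_eq_iff[of "map (\<lambda>(c, a). (c d * a d ^ K, a d)) ps" e b]
    by (simp add: o_def case_prod_unfold power_add mult.assoc)
  have pf: "fst p \<in> polynomial_funs" "snd p \<in> polynomial_funs" if "p \<in> set ps" for p
    using ps that by auto
  show ?thesis
    unfolding split tail unfolding case_prod_unfold
    by (intro semi_polyhedral_conj semi_polyhedral_Ball semi_polyhedral_disj semi_polyhedral_eq
        semi_polyhedral_le finite_set finite_lessThan polynomial_funs_sum_list
        polynomial_funs_mult polynomial_funs_power polynomial_funs_const pf)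
qed

end

end

end

section \<open>Assembly from a finite prefix and finitely many residue classes\<close>

theorem theorem2:
  fixes SS :: "nat \<Rightarrow> ('n::finite, 'a::comm_semiring_1) mpoly"
    and S :: "nat \<Rightarrow> 'a"
  assumes "idempotent_sr TYPE('a)"
    and "linearly_ordered_sr TYPE('a)"
    and "archimedian_sr TYPE('a)"
    and "cancellative_sr TYPE('a)"
    and "SS \<in> rational_series"
    and "S \<in> rational_series"
  shows "semi_polyhedral {d :: 'n \<Rightarrow> 'a. subst_ser SS d = S}"
proof -
  note idem = sr_add_idem[OF assms(1,2)]
  let ?F = "\<lambda>d :: 'n \<Rightarrow> 'a. Abs_fps (\<lambda>k. mpoly_eval (SS k) d)"
  let ?G = "\<lambda>d :: 'n \<Rightarrow> 'a. Abs_fps S"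
  obtain L where L: "L > 0" "?F \<in> star_normal L"
    using star_normal_rational[where h = mpoly_eval, OF idem assms(5) polynomial_funs_mpoly_eval
        mpoly_eval_0 mpoly_eval_1 mpoly_eval_add mpoly_eval_mult] by blast
  obtain M where M: "M > 0" "?G \<in> star_normal M"
    using star_normal_rational[where h = "\<lambda>x _. x", OF idem assms(6) polynomial_funs_const]
    by blast
  define P where "P = L * M"
  have P: "P > 0" "?F \<in> star_normal P" "?G \<in> star_normal P"
    using L M star_normal_multiple[OF L(2,1) M(1)] star_normal_multiple[OF M(2,1) L(1)]
    by (simp_all add: P_def mult.commute)
  obtain N1 where N1: "\<And>n. n \<ge> N1 \<Longrightarrow> \<exists>ps. set ps \<subseteq> polynomial_funs \<times> polynomial_funs \<and>
      (\<forall>d k. mpoly_eval (SS (n + P * k)) d = (\<Sum>(c, a)\<leftarrow>ps. c d * a d ^ k))"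
    using star_normal_eventually[OF P(2,1)] unfolding fps_nth_Abs_fps by blast
  obtain N2 where N2: "\<And>n. n \<ge> N2 \<Longrightarrow> \<exists>ps. set ps \<subseteq> polynomial_funs \<times> polynomial_funs \<and>
      (\<forall>(d :: 'n \<Rightarrow> 'a) k. S (n + P * k) = (\<Sum>(c, a)\<leftarrow>ps. c d * a d ^ k))"
    using star_normal_eventually[OF P(3,1)] unfolding fps_nth_Abs_fps by blast
  define N where "N = max N1 N2"
  have prefix: "semi_polyhedral {d. mpoly_eval (SS n) d = S n}" for n
    by (intro semi_polyhedral_eq[OF assms(1,2)] polynomial_funs_mpoly_eval polynomial_funs_const)
  have progression:
    "semi_polyhedral {d. \<forall>k. mpoly_eval (SS (N + r + P * k)) d = S (N + r + P * k)}" for r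
  proof -
    have N: "N + r \<ge> N1" "N + r \<ge> N2"
      by (simp_all add: N_def)
    obtain ps where ps: "set ps \<subseteq> polynomial_funs \<times> polynomial_funs"
      "\<And>d k. mpoly_eval (SS (N + r + P * k)) d = (\<Sum>(c, a)\<leftarrow>ps. c d * a d ^ k)"
      using N1[OF N(1)] by blast
    obtain qs :: "((('n \<Rightarrow> 'a) \<Rightarrow> 'a) \<times> (('n \<Rightarrow> 'a) \<Rightarrow> 'a)) list" where
      qs: "\<And>d k. S (N + r + P * k) = (\<Sum>(c, a)\<leftarrow>qs. c d * a d ^ k)"
      using N2[OF N(2)] by blast
    \<comment> \<open>The pairs in \<open>qs\<close> are functions of \<open>d\<close> although the
      sum is independent of \<open>d\<close>; evaluating at the zero point gives fixed
      scalars.\<close>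
    have S: "S (N + r + P * k) = (\<Sum>(e, b)\<leftarrow>map (\<lambda>(c, a). (c (\<lambda>_. 0), a (\<lambda>_. 0))) qs. e * b ^ k)" for k
      using qs[of k "\<lambda>_. 0"] by (simp add: o_def case_prod_unfold)
    then show ?thesis
      using semi_polyhedral_geometric_sum_eq[OF assms(1-4) ps(1)] by (simp only: ps(2) S)
  qed
  \<comment> \<open>Each index from \<open>N\<close> on is \<open>N + r + P * k\<close> with
    \<open>r < P\<close>, by division of \<open>n - N\<close> by \<open>P\<close>.\<close>
  have "(\<forall>n. mpoly_eval (SS n) d = S n) \<longleftrightarrow> (\<forall>n\<in>{..<N}. mpoly_eval (SS n) d = S n) \<and>
      (\<forall>r\<in>{..<P}. \<forall>k. mpoly_eval (SS (N + r + P * k)) d = S (N + r + P * k))" (is "_ \<longleftrightarrow> ?R") for d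
  proof
    assume R: ?R
    show "\<forall>n. mpoly_eval (SS n) d = S n"
    proof
      fix n
      show "mpoly_eval (SS n) d = S n"
      proof (cases "n < N")
        case False
        then have n: "N + (n - N) mod P + P * ((n - N) div P) = n"
          by simp
        have "(n - N) mod P \<in> {..<P}"
          using \<open>P > 0\<close> by simp
        then have "mpoly_eval (SS (N + (n - N) mod P + P * ((n - N) div P))) d =
            S (N + (n - N) mod P + P * ((n - N) div P))"
          using R by blast
        then show ?thesis by (simp only: n)
      qed (use R in auto)
    qed
  qed blast
  then have "{d. subst_ser SS d = S} = {d. (\<forall>n\<in>{..<N}. mpoly_eval (SS n) d = S n) \<and>
      (\<forall>r\<in>{..<P}. \<forall>k. mpoly_eval (SS (N + r + P * k)) d = S (N + r + P * k))}"
    by (simp only: subst_ser_def fun_eq_iff)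
  then show ?thesis
    by (simp only:) (intro semi_polyhedral_conj semi_polyhedral_Ball prefix progression finite_lessThan)
qed

end
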